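(* Let $a<b$ be real numbers, let $1<\alpha\le 2$, let $f:\mathbb{R}_+\to\mathbb{R}_+$ be continuous, and let $q:[a,b]\to\mathbb{R}_+$ be a nontrivial (i.e. not almost everywhere zero) Lebesgue integrable function. Let $G$ and $\varphi$ be the functions defined in the context, and set $$\gamma:=\left(\int_a^b G(s,s)\,q(s)\,ds\right)^{-1},\qquad \gamma^{*}:=\left(\int_{\frac{2a+b}{3}}^{\frac{a+2b}{3}} G(s,s)\,\varphi(s)\,q(s)\,ds\right)^{-1},$$ where the integral defining $\gamma^*$ is assumed to be nonzero, so that $\gamma^*$ is well defined. Assume that there exist two constants $r_2>r_1>0$ such that $$f(y)\ge \gamma^{*} r_1 \ \text{ for all } y\in[0,r_1],\qquad f(y)\le \gamma\, r_2\ \text{ for all } y\in[0,r_2].$$ Then the fractional boundary value problem $$\begin{cases} {}_aD^{\alpha}y+q(t)f(y)=0,\quad a<t<b,\\ y(a)=y(b)=0\end{cases}$$ has at least one nontrivial positive solution $y\in C[a,b]$ such that $r_1\le\|y\|\le r_2$.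
   Context: $\mathbb{R}_+=[0,\infty)$. $C[a,b]$ is the Banach space of continuous real functions on $[a,b]$ with norm $\|u\|=\sup_{t\in[a,b]}|u(t)|$. The (left) Riemann--Liouville fractional derivative of order $\alpha>0$ of $u:[a,b]\to\mathbb{R}$ is $${}_aD^{\alpha}u(t)=\frac{1}{\Gamma(n-\alpha)}\frac{d^n}{dt^n}\int_a^t\frac{u(s)}{(t-s)^{\alpha-n+1}}\,ds,\qquad n=[\alpha]+1.$$ The Green function of the problem is $$G(t,s)=\frac{1}{\Gamma(\alpha)}\begin{cases}\dfrac{(t-a)^{\alpha-1}(b-s)^{\alpha-1}}{(b-a)^{\alpha-1}}-(t-s)^{\alpha-1}, & a\le s\le t\le b,\\[2mm] \dfrac{(t-a)^{\alpha-1}(b-s)^{\alpha-1}}{(b-a)^{\alpha-1}}, & a\le t\le s\le b.\end{cases}$$ Solutions of the boundary value problem are understood through the equivalent integral equation: $y\in C[a,b]$ with values in $\mathbb{R}_+$ is a solution if and only if $y(t)=\int_a^b G(t,s)q(s)f(y(s))\,ds$ for all $t\in[a,b]$. "Positive" means $y(t)\ge 0$ for all $t\in[a,b]$, and "nontrivial" means not identically zero. Let $\lambda$ be the unique point of $\left(\frac{2a+b}{3},\frac{a+2b}{3}\right)$ with $g_1\left(\frac{a+2b}{3},\lambda\right)=g_2\left(\frac{2a+b}{3},\lambda\right)$, where $g_1(t,s)=\frac{1}{\Gamma(\alpha)}\left[\frac{(t-a)^{\alpha-1}(b-s)^{\alpha-1}}{(b-a)^{\alpha-1}}-(t-s)^{\alpha-1}\right]$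 and $g_2(t,s)=\frac{1}{\Gamma(\alpha)}\frac{(t-a)^{\alpha-1}(b-s)^{\alpha-1}}{(b-a)^{\alpha-1}}$. The function $\varphi:(a,b)\to(0,\infty)$ is $$\varphi(s)=\begin{cases}\dfrac{\left(\frac{2(b-a)(b-s)}{3}\right)^{\alpha-1}-(b-a)^{\alpha-1}\left(\frac{a+2b}{3}-s\right)^{\alpha-1}}{((s-a)(b-s))^{\alpha-1}}, & s\in(a,\lambda],\\[3mm] \left(\dfrac{b-a}{3(s-a)}\right)^{\alpha-1}, & s\in[\lambda,b).\end{cases}$$ *)

theory Defs
  imports "HOL-Analysis.Analysis"
begin

definition g1 :: "real \<Rightarrow> real \<Rightarrow> real \<Rightarrow> real \<Rightarrow> real \<Rightarrow> real" where
  "g1 \<alpha> a b t s = 1 / Gamma \<alpha> *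
     ((t - a) powr (\<alpha> - 1) * (b - s) powr (\<alpha> - 1) / (b - a) powr (\<alpha> - 1)
       - (t - s) powr (\<alpha> - 1))"

definition g2 :: "real \<Rightarrow> real \<Rightarrow> real \<Rightarrow> real \<Rightarrow> real \<Rightarrow> real" where
  "g2 \<alpha> a b t s = 1 / Gamma \<alpha> *
     ((t - a) powr (\<alpha> - 1) * (b - s) powr (\<alpha> - 1) / (b - a) powr (\<alpha> - 1))"

text \<open>The two branches agree on the diagonal, since \<open>0 powr (\<alpha> - 1) = 0\<close>.\<close>

definition green :: "real \<Rightarrow> real \<Rightarrow> real \<Rightarrow> real \<Rightarrow> real \<Rightarrow> real" where
  "green \<alpha> a b t s = (if s \<le> t then g1 \<alpha> a b t s else g2 \<alpha> a b t s)"

definition switch_point :: "real \<Rightarrow> real \<Rightarrow> real \<Rightarrow> real" where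
  "switch_point \<alpha> a b =
     (THE s. s \<in> {(2 * a + b) / 3 <..< (a + 2 * b) / 3} \<and>
             g1 \<alpha> a b ((a + 2 * b) / 3) s = g2 \<alpha> a b ((2 * a + b) / 3) s)"

text \<open>Only the values on the open interval from \<open>a\<close> to \<open>b\<close> are meaningful.\<close>

definition phi :: "real \<Rightarrow> real \<Rightarrow> real \<Rightarrow> real \<Rightarrow> real" where
  "phi \<alpha> a b s =
     (if s \<le> switch_point \<alpha> a b
      then ((2 * (b - a) * (b - s) / 3) powr (\<alpha> - 1)
             - (b - a) powr (\<alpha> - 1) * ((a + 2 * b) / 3 - s) powr (\<alpha> - 1))
           / ((s - a) * (b - s)) powr (\<alpha> - 1)
      else ((b - a) / (3 * (s - a))) powr (\<alpha> - 1))"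

definition gamma_const :: "real \<Rightarrow> real \<Rightarrow> real \<Rightarrow> (real \<Rightarrow> real) \<Rightarrow> real" where
  "gamma_const \<alpha> a b q = inverse (LINT s:{a..b}|lebesgue. green \<alpha> a b s s * q s)"

definition gamma_star_integral :: "real \<Rightarrow> real \<Rightarrow> real \<Rightarrow> (real \<Rightarrow> real) \<Rightarrow> real" where
  "gamma_star_integral \<alpha> a b q =
     (LINT s:{(2 * a + b) / 3 .. (a + 2 * b) / 3}|lebesgue. green \<alpha> a b s s * phi \<alpha> a b s * q s)"

definition gamma_star :: "real \<Rightarrow> real \<Rightarrow> real \<Rightarrow> (real \<Rightarrow> real) \<Rightarrow> real" where
  "gamma_star \<alpha> a b q = inverse (gamma_star_integral \<alpha> a b q)"

definition sup_norm :: "real \<Rightarrow> real \<Rightarrow> (real \<Rightarrow> real) \<Rightarrow> real" where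
  "sup_norm a b u = (SUP t\<in>{a..b}. \<bar>u t\<bar>)"

text \<open>
  Positive solutions in \<open>C[a,b]\<close> of the Riemann--Liouville boundary value problem
  \<open>D\<^sup>\<alpha> y + q f(y) = 0\<close> on \<open>(a,b)\<close> with \<open>y(a) = y(b) = 0\<close>.  As \<open>q\<close> is only integrable,
  a solution is by convention a solution of the integral equation given by the Green function
  of the problem.  The boundary conditions are contained in the integral equation: see
  \<open>bvp_solution_boundary\<close> below.
\<close>

definition bvp_positive_solution ::
    "real \<Rightarrow> real \<Rightarrow> real \<Rightarrow> (real \<Rightarrow> real) \<Rightarrow> (real \<Rightarrow> real) \<Rightarrow> (real \<Rightarrow> real) \<Rightarrow> bool" where
  "bvp_positive_solution \<alpha> a b q f y \<longleftrightarrow>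
     continuous_on {a..b} y \<and> (\<forall>t\<in>{a..b}. 0 \<le> y t) \<and>
     (\<forall>t\<in>{a..b}. y t = (LINT s:{a..b}|lebesgue. green \<alpha> a b t s * q s * f (y s)))"

lemma bvp_solution_boundary:
  assumes "a < b" "1 < \<alpha>" "bvp_positive_solution \<alpha> a b q f y"
  shows "y a = 0" "y b = 0"
proof -
  have "y t = 0" if t: "t = a \<or> t = b" for t
  proof -
    have "green \<alpha> a b t s = 0" if "s \<in> {a..b}" for s
      using t that assms(1,2) by (auto simp: green_def g1_def g2_def)
    then have "(LINT s:{a..b}|lebesgue. green \<alpha> a b t s * q s * f (y s)) = (LINT s:{a..b}|lebesgue. 0)"
      by (intro set_lebesgue_integral_cong) auto
    then show ?thesis
      using t assms unfolding bvp_positive_solution_def by (auto simp: set_lebesgue_integral_def)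
  qed
  then show "y a = 0" "y b = 0" by auto
qed

text \<open>The definite description in \<open>switch_point\<close> is well defined.\<close>

lemma switch_point_ex1:
  fixes a b \<alpha> :: real
  assumes ab: "a < b" and al: "1 < \<alpha>" "\<alpha> \<le> 2"
  shows "\<exists>!s. s \<in> {(2 * a + b) / 3 <..< (a + 2 * b) / 3} \<and>
             g1 \<alpha> a b ((a + 2 * b) / 3) s = g2 \<alpha> a b ((2 * a + b) / 3) s"
proof -
  define p c d where "p = \<alpha> - 1" and "c = (2 * a + b) / 3" and "d = (a + 2 * b) / 3"
  have p: "0 < p" "p \<le> 1" using al by (auto simp: p_def)
  have cd: "a < c" "c < d" "d < b" using ab by (auto simp: c_def d_def)
  have "(d - a) / (b - a) = 2/3" "(c - a) / (b - a) = 1/3"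
    using ab by (auto simp: c_def d_def field_simps)
  then have k: "(d - a) powr p / (b - a) powr p = (2/3) powr p"
               "(c - a) powr p / (b - a) powr p = (1/3) powr p"
    using cd by (metis powr_divide less_eq_real_def diff_gt_0_iff_gt order_less_trans)+
  define h where "h s = (2/3) powr p * (b - s) powr p - (d - s) powr p - (1/3) powr p * (b - s) powr p" for s
  have G: "Gamma \<alpha> > 0" using al by (intro Gamma_real_pos) auto
  have eq: "g1 \<alpha> a b d s = g2 \<alpha> a b c s \<longleftrightarrow> h s = 0" for s
  proof -
    have "(d - a) powr p * (b - s) powr p / (b - a) powr p = (2/3) powr p * (b - s) powr p"
         "(c - a) powr p * (b - s) powr p / (b - a) powr p = (1/3) powr p * (b - s) powr p"
      by (simp_all add: k[symmetric])
    then show ?thesis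
      using G unfolding g1_def g2_def h_def p_def[symmetric] by simp
  qed
  have cont: "continuous_on {c..d} h"
    unfolding h_def using p cd by (intro continuous_on_diff continuous_on_mult continuous_on_powr' continuous_on_const continuous_on_id) auto
  have k01: "(1/3) powr p < (2/3::real) powr p" "(2/3::real) powr p < 1"
    using p powr_less_mono2[of p "1/3" "2/3"] powr_less_mono2[of p "2/3" 1] by auto
  have mono: "h x < h y" if xy: "c \<le> x" "x < y" "y \<le> d" for x y
  proof (rule DERIV_pos_imp_increasing_open[OF xy(2)])
    show "continuous_on {x..y} h"
      using cont xy by (auto intro: continuous_on_subset)
    fix s assume s: "x < s" "s < y"
    have pos: "b - s > 0" "d - s > 0" using s xy cd by auto
    have D: "(h has_real_derivative
       (p * (d - s) powr (p - 1) - ((2/3) powr p - (1/3) powr p) * (p * (b - s) powr (p - 1)))) (at s)"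
      unfolding h_def using pos by (auto intro!: derivative_eq_intros simp: algebra_simps)
    have "(b - s) powr (p - 1) \<le> (d - s) powr (p - 1)"
      using pos cd p by (intro powr_mono2') auto
    moreover have "(b - s) powr (p - 1) > 0" using pos by simp
    moreover have "((2/3::real) powr p - (1/3) powr p) * (b - s) powr (p - 1) < 1 * (b - s) powr (p - 1)"
      using k01 pos by (intro mult_strict_right_mono) (auto intro: order_less_le_trans[of _ "(2/3) powr p"])
    ultimately have "((2/3::real) powr p - (1/3) powr p) * (b - s) powr (p - 1) < (d - s) powr (p - 1)"
      by linarith
    then have "p * (((2/3::real) powr p - (1/3) powr p) * (b - s) powr (p - 1)) < p * (d - s) powr (p - 1)"
      using p by simp
    then show "\<exists>v. (h has_real_derivative v) (at s) \<and> 0 < v"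
      using D by (intro exI conjI) (auto simp: algebra_simps)
  qed
  have "h d > 0"
    using k01 p cd by (simp add: h_def mult_strict_right_mono)
  moreover have "h c < 0"
  proof -
    define L where "L = b - a"
    have L: "L > 0" "b - c = 2/3 * L" "d - c = 1/3 * L"
      using ab by (auto simp: L_def c_def d_def field_simps)
    have pw: "x \<le> x powr p" if "0 < x" "x \<le> 1" for x :: real
      using that p powr_mono'[of p 1 x] by simp
    have e1: "(4/9::real) powr p * (3/4) powr p = (1/3) powr p"
      and e2: "(4/9::real) powr p * (1/4) powr p = (1/9) powr p"
      by (simp_all add: powr_mult[symmetric])
    have "(4/9::real) powr p * 1 \<le> (4/9) powr p * ((3/4) powr p + (1/4) powr p)"
      using pw[of "3/4"] pw[of "1/4"] by (intro mult_left_mono) auto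
    then have "(4/9::real) powr p \<le> (1/3) powr p + (1/9) powr p"
      by (simp add: distrib_left e1 e2)
    moreover have "(1/9::real) powr p < (2/9) powr p" using p by (intro powr_less_mono2) auto
    ultimately have "(4/9::real) powr p - (1/3) powr p - (2/9) powr p < 0" by linarith
    moreover have "h c = ((4/9) powr p - (1/3) powr p - (2/9) powr p) * L powr p"
    proof -
      have "(2/3) powr p * (2/3 * L) powr p = (4/9) powr p * L powr p"
           "(1/3) powr p * (2/3 * L) powr p = (2/9) powr p * L powr p"
           "(1/3 * L) powr p = (1/3) powr p * L powr p"
        using L(1) by (simp_all add: powr_mult[symmetric])
      then show ?thesis unfolding h_def L(2,3) by (simp only: left_diff_distrib)
    qed
    ultimately show ?thesis using L(1) by (simp add: mult_less_0_iff)
  qed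
  ultimately obtain s where s: "c \<le> s" "s \<le> d" "h s = 0"
    using IVT'[of h c 0 d] cont cd by auto
  then have "c < s" "s < d" using \<open>h d > 0\<close> \<open>h c < 0\<close> by (auto simp: less_le)
  moreover have "s' = s" if "c < s'" "s' < d" "h s' = 0" for s'
    using that s mono[of s s'] mono[of s' s] by (cases s s' rule: linorder_cases) auto
  ultimately show ?thesis
    unfolding c_def[symmetric] d_def[symmetric] eq
    using s(3) unfolding greaterThanLessThan_iff by blast
qed

end

theory Submission
  imports Defs "HOL-Complex_Analysis.Great_Picard"
begin

text \<open>
  A fixed point of the Green operator \<open>T y t = \<integral> G(t,s) q(s) f(y(s)) ds\<close> is sought with norm
  between \<open>r1\<close> and \<open>r2\<close>.  The upper bound on \<open>f\<close>, together with \<open>G(t,s) \<le> G(s,s)\<close>, makes \<open>T\<close> a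
  self map of the convex set of continuous functions with values in \<open>{0..r2}\<close>.  The operator is
  compact, so Schauder's theorem gives a fixed point \<open>y\<close> in this set.

  The lower bound on \<open>f\<close> keeps \<open>y\<close> from being small.  If \<open>y\<close> stayed below \<open>r1\<close>,
  then \<open>f(y(s)) \<ge> \<gamma>* r1\<close> for every \<open>s\<close>.  On the middle third of the interval
  \<open>G(t,s) \<ge> \<phi>(s) G(s,s)\<close>, so there
  \<open>y(t) = T y t \<ge> \<gamma>* r1 \<integral> \<phi>(s) G(s,s) q(s) ds = r1\<close>, a contradiction.  So every fixed
  point in the set has norm at least \<open>r1\<close>.

  Schauder's theorem is proved here for Hammerstein operators with a continuous kernel
  (\<open>fixed_point_exists\<close>).  Kuhn's lemma gives approximate fixed points of the operator discretised by
  step functions (\<open>approximate_fixed_point\<close>), and these are passed to the limit by the Arzela--Ascoli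
  theorem.  The two bounds on \<open>G\<close> (\<open>green_le_diagonal\<close>, \<open>green_ge_diagonal_times_phi\<close>) hold because
  \<open>G(\<cdot>,s)\<close> increases on \<open>[a,s]\<close> and decreases on \<open>[s,b]\<close>, and because \<open>\<phi>(s) G(s,s)\<close> is the smaller of
  the values that bound \<open>G(\<cdot>,s)\<close> from below at the two ends of the middle third.
\<close>

section \<open>Approximate fixed points in a cube\<close>

text \<open>
  Brouwer's fixed point theorem in an approximate form, for a cube whose dimension \<open>n\<close> is a
  number, so that it can tend to infinity when an operator is discretised.  It is read off from
  Kuhn's lemma.  Label a grid point in direction \<open>i\<close> by whether \<open>F\<close> moves
  it up or down in that direction.  Kuhn's cell has for every \<open>i\<close> two corners with different labels,
  so \<open>F x i - x i\<close> takes a nonnegative and a nonpositive value on the cell and is small everywhere on it.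
\<close>

lemma approximate_fixed_point_cube:
  fixes F :: "(nat \<Rightarrow> real) \<Rightarrow> nat \<Rightarrow> real"
  assumes "0 < R" "0 < \<delta>"
    and range: "\<And>x i. (\<And>j. j < n \<Longrightarrow> x j \<in> {0..R}) \<Longrightarrow> i < n \<Longrightarrow> F x i \<in> {0..R}"
    and unif: "\<And>x x' i. (\<And>j. j < n \<Longrightarrow> x j \<in> {0..R}) \<Longrightarrow> (\<And>j. j < n \<Longrightarrow> x' j \<in> {0..R}) \<Longrightarrow>
      (\<And>j. j < n \<Longrightarrow> \<bar>x j - x' j\<bar> \<le> \<delta>) \<Longrightarrow> i < n \<Longrightarrow> \<bar>F x i - F x' i\<bar> \<le> \<epsilon>"
  obtains x where "\<And>j. j < n \<Longrightarrow> x j \<in> {0..R}" "\<And>i. i < n \<Longrightarrow> \<bar>F x i - x i\<bar> \<le> \<epsilon> + \<delta>"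
proof -
  obtain p :: nat where p: "R / \<delta> < p" using reals_Archimedean2 by blast
  have p0: "0 < real p" using p assms(1,2) by (meson divide_pos_pos order_less_trans)
  have mesh: "R / p \<le> \<delta>" using p p0 assms(2) by (simp add: field_simps)
  define pt where "pt v = (\<lambda>i. R * real (v i) / real p)" for v :: "nat \<Rightarrow> nat"
  \<comment> \<open>The condition \<open>v i \<noteq> p\<close> forces label 1 on the upper face, even if \<open>F\<close> fixes the point in
     direction \<open>i\<close>.\<close>
  define label where "label v i = (if v i \<noteq> p \<and> pt v i \<le> F (pt v) i then 0 else 1 :: nat)" for v i
  have cube: "pt v j \<in> {0..R}" if "v j \<le> p" for v j
  proof -
    have "R * real (v j) \<le> R * real p" using that assms(1) by (intro mult_left_mono) auto
    then show ?thesis using assms(1) p0 by (simp add: pt_def field_simps)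
  qed
  obtain v where v: "\<forall>i<n. v i < p"
    and cell: "\<forall>i<n. \<exists>r s. (\<forall>j<n. v j \<le> r j \<and> r j \<le> v j + 1) \<and>
                 (\<forall>j<n. v j \<le> s j \<and> s j \<le> v j + 1) \<and> label r i \<noteq> label s i"
  proof (rule kuhn_lemma[of p n label])
    show "\<forall>x. (\<forall>i<n. x i \<le> p) \<longrightarrow> (\<forall>i<n. x i = 0 \<longrightarrow> label x i = 0)"
    proof (intro allI impI)
      fix x i assume x: "\<forall>i<n. x i \<le> p" and i: "i < n" "x i = 0"
      then have "0 \<le> F (pt x) i" using range[of "pt x" i] cube by auto
      then show "label x i = 0" using i p0 by (simp add: label_def pt_def)
    qed
  qed (use p0 in \<open>auto simp: label_def\<close>)
  have lo: "- (\<epsilon> + \<delta>) \<le> F (pt v) i - pt v i \<and> F (pt v) i - pt v i \<le> \<epsilon> + \<delta>" if i: "i < n" for i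
  proof -
    have key: "\<bar>F (pt v) i - F (pt w) i\<bar> \<le> \<epsilon> \<and> \<bar>pt v i - pt w i\<bar> \<le> \<delta> \<and> pt w i \<in> {0..R} \<and> F (pt w) i \<in> {0..R}"
      if w: "\<forall>j<n. v j \<le> w j \<and> w j \<le> v j + 1" for w
    proof -
      have wp: "w j \<le> p" if "j < n" for j using w v that by fastforce
      have close: "\<bar>pt v j - pt w j\<bar> \<le> \<delta>" if "j < n" for j
      proof -
        have "real (w j) - real (v j) \<in> {0..1}" using w that by fastforce
        then have "R * (real (w j) - real (v j)) / p \<le> R * 1 / p" "0 \<le> R * (real (w j) - real (v j)) / p"
          using assms(1) p0 by (intro divide_right_mono mult_left_mono divide_nonneg_pos mult_nonneg_nonneg; simp)+
        moreover have "pt w j - pt v j = R * (real (w j) - real (v j)) / p"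
          by (simp add: pt_def diff_divide_distrib right_diff_distrib)
        ultimately show ?thesis using mesh by auto
      qed
      have vp: "v j \<le> p" if "j < n" for j using v that by (simp add: less_imp_le)
      show ?thesis
        using unif[of "pt v" "pt w" i] cube vp wp close i range[of "pt w" i] by blast
    qed
    obtain r s where r: "\<forall>j<n. v j \<le> r j \<and> r j \<le> v j + 1" and s: "\<forall>j<n. v j \<le> s j \<and> s j \<le> v j + 1"
      and "label r i = 0" "label s i = 1"
    proof -
      obtain r s where rs: "\<forall>j<n. v j \<le> r j \<and> r j \<le> v j + 1" "\<forall>j<n. v j \<le> s j \<and> s j \<le> v j + 1"
        "label r i \<noteq> label s i" using cell i by blast
      then consider "label r i = 0" "label s i = 1" | "label s i = 0" "label r i = 1"
        by (auto simp: label_def split: if_splits)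
      then show thesis using that rs by cases blast+
    qed
    then have "pt r i \<le> F (pt r) i" "F (pt s) i \<le> pt s i"
      using key[OF s] p0 assms(1) by (auto simp: label_def pt_def split: if_splits)
    then show ?thesis using key[OF r] key[OF s] by auto
  qed
  show thesis
    by (rule that[of "pt v"]) (use lo cube v in \<open>auto simp: abs_le_iff less_imp_le\<close>, fastforce+)
qed

section \<open>Bounded functions times an integrable weight\<close>

text \<open>
  The continuity estimates for the integral operator are instances: the difference of two integrands
  is a uniformly small measurable function times the integrable weight.
\<close>

lemma weighted_integral_bound:
  fixes g w :: "'a \<Rightarrow> real"
  assumes w: "set_integrable M S w" "\<And>s. s \<in> S \<Longrightarrow> 0 \<le> w s"
    and g: "set_borel_measurable M S g" "\<And>s. s \<in> S \<Longrightarrow> \<bar>g s\<bar> \<le> C"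
  shows "set_integrable M S (\<lambda>s. g s * w s)"
    and "\<bar>LINT s:S|M. g s * w s\<bar> \<le> C * (LINT s:S|M. w s)"
proof -
  have bd: "\<bar>g s * w s\<bar> \<le> C * w s" if "s \<in> S" for s
    using mult_right_mono[OF g(2)[OF that] w(2)[OF that]] w(2)[OF that] by (simp add: abs_mult)
  have Cw: "set_integrable M S (\<lambda>s. C * w s)" using w(1) by simp
  have eq: "(\<lambda>s. indicator S s *\<^sub>R (g s * w s)) = (\<lambda>s. (indicator S s *\<^sub>R g s) * (indicator S s *\<^sub>R w s))"
    by (auto simp: indicator_def)
  have meas: "set_borel_measurable M S (\<lambda>s. g s * w s)"
    unfolding set_borel_measurable_def eq
    using g(1) w(1) unfolding set_borel_measurable_def set_integrable_def
    by (intro borel_measurable_times) auto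
  show int: "set_integrable M S (\<lambda>s. g s * w s)"
    by (rule set_integrable_bound[OF Cw meas]) (use bd in \<open>auto intro!: AE_I2 order_trans[OF _ abs_ge_self]\<close>)
  have "norm (LINT s:S|M. g s * w s) \<le> (LINT s:S|M. norm (g s * w s))"
    by (rule set_integral_norm_bound[OF int])
  also have "\<dots> \<le> (LINT s:S|M. C * w s)"
    by (intro set_integral_mono set_integrable_norm int Cw) (use bd in auto)
  finally show "\<bar>LINT s:S|M. g s * w s\<bar> \<le> C * (LINT s:S|M. w s)" by simp
qed

lemma set_borel_measurable_mult:
  fixes f g :: "'a \<Rightarrow> real"
  assumes "set_borel_measurable M S f" "set_borel_measurable M S g"
  shows "set_borel_measurable M S (\<lambda>s. f s * g s)"
proof -
  have "(\<lambda>s. indicator S s *\<^sub>R (f s * g s)) = (\<lambda>s. (indicator S s *\<^sub>R f s) * (indicator S s *\<^sub>R g s))"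
    by (auto simp: indicator_def)
  then show ?thesis using assms unfolding set_borel_measurable_def by simp
qed

lemma set_borel_measurable_diff:
  fixes f g :: "'a \<Rightarrow> real"
  assumes "set_borel_measurable M S f" "set_borel_measurable M S g"
  shows "set_borel_measurable M S (\<lambda>s. f s - g s)"
proof -
  have "(\<lambda>s. indicator S s *\<^sub>R (f s - g s)) = (\<lambda>s. (indicator S s *\<^sub>R f s) - (indicator S s *\<^sub>R g s))"
    by (auto simp: indicator_def)
  then show ?thesis using assms unfolding set_borel_measurable_def by simp
qed

lemma set_borel_measurable_continuous_lebesgue:
  fixes f :: "real \<Rightarrow> real"
  assumes "continuous_on {a..b} f"
  shows "set_borel_measurable lebesgue {a..b} f"
proof -
  have "(\<lambda>s. indicator {a..b} s *\<^sub>R f s) \<in> borel_measurable borel"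
    by (rule borel_measurable_continuous_on_indicator[OF _ assms]) simp
  then show ?thesis
    unfolding set_borel_measurable_def by (intro measurable_completion) simp
qed

section \<open>Hammerstein integral equations\<close>

text \<open>
  Hammerstein integral equations \<open>y t = \<integral> K t s * q s * f (y s) ds\<close> on a compact interval.  Together with
  the bound \<open>f x \<le> M\<close>, the hypothesis \<open>self_map\<close> ensures that the integral operator maps functions
  with values in \<open>{0..R}\<close> to such functions.
\<close>

locale hammerstein =
  fixes a b R M :: real and K :: "real \<Rightarrow> real \<Rightarrow> real" and q f :: "real \<Rightarrow> real"
  assumes ab: "a < b" and R: "0 < R"
    and K_cont: "continuous_on ({a..b} \<times> {a..b}) (\<lambda>(t, s). K t s)"
    and K_nonneg: "\<And>t s. t \<in> {a..b} \<Longrightarrow> s \<in> {a..b} \<Longrightarrow> 0 \<le> K t s"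
    and q_int: "set_integrable lebesgue {a..b} q"
    and q_nonneg: "\<And>s. s \<in> {a..b} \<Longrightarrow> 0 \<le> q s"
    and f_cont: "continuous_on {0..R} f"
    and f_range: "\<And>x. x \<in> {0..R} \<Longrightarrow> f x \<in> {0..M}"
    and self_map: "\<And>t. t \<in> {a..b} \<Longrightarrow> M * (LINT s:{a..b}|lebesgue. K t s * q s) \<le> R"
begin

definition T :: "(real \<Rightarrow> real) \<Rightarrow> real \<Rightarrow> real" where
  "T y t = (LINT s:{a..b}|lebesgue. K t s * q s * f (y s))"

text \<open>
  The operator is studied on a class that contains step functions as well as continuous functions.
  Measurability is required of \<open>f \<circ> y\<close>, the function that is integrated; for a step function \<open>y\<close> it
  holds whatever \<open>f\<close> is.
\<close>

definition admissible :: "(real \<Rightarrow> real) \<Rightarrow> bool" where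
  "admissible y \<longleftrightarrow> y \<in> {a..b} \<rightarrow> {0..R} \<and> set_borel_measurable lebesgue {a..b} (\<lambda>s. f (y s))"

definition weight_mass :: real where "weight_mass = (LINT s:{a..b}|lebesgue. q s)"

lemma weight_mass_nonneg: "0 \<le> weight_mass"
  unfolding weight_mass_def set_lebesgue_integral_def
  by (rule integral_nonneg_AE) (auto simp: indicator_def q_nonneg)

lemma K_measurable: "t \<in> {a..b} \<Longrightarrow> set_borel_measurable lebesgue {a..b} (K t)"
  by (intro set_borel_measurable_continuous_lebesgue continuous_on_compose2[OF K_cont, of _ "\<lambda>s. (t, s)", simplified])
     (auto intro!: continuous_intros)

lemma K_bounded: obtains B where "0 < B" "\<And>t s. t \<in> {a..b} \<Longrightarrow> s \<in> {a..b} \<Longrightarrow> \<bar>K t s\<bar> \<le> B"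
proof -
  have "bounded ((\<lambda>(t, s). K t s) ` ({a..b} \<times> {a..b}))"
    by (intro compact_imp_bounded compact_continuous_image K_cont compact_Times) auto
  then obtain B where "0 < B" "\<forall>x \<in> (\<lambda>(t, s). K t s) ` ({a..b} \<times> {a..b}). norm x \<le> B"
    unfolding bounded_pos by blast
  then show thesis by (intro that[of B]) auto
qed

lemma K_q_integrable: "t \<in> {a..b} \<Longrightarrow> set_integrable lebesgue {a..b} (\<lambda>s. K t s * q s)"
  using K_bounded weighted_integral_bound(1)[OF q_int q_nonneg K_measurable] by metis

lemma admissible_fD: "admissible y \<Longrightarrow> s \<in> {a..b} \<Longrightarrow> y s \<in> {0..R} \<and> f (y s) \<in> {0..M}"
  using f_range by (auto simp: admissible_def Pi_iff)

lemma integrand_integrable: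
  assumes "admissible y" "t \<in> {a..b}"
  shows "set_integrable lebesgue {a..b} (\<lambda>s. K t s * q s * f (y s))"
proof -
  have "set_integrable lebesgue {a..b} (\<lambda>s. f (y s) * (K t s * q s))"
    by (rule weighted_integral_bound(1)[where C = M])
       (use assms K_q_integrable K_nonneg q_nonneg admissible_fD[OF assms(1)] in \<open>auto simp: admissible_def\<close>)
  then show ?thesis by (simp add: mult.commute)
qed

lemma T_range:
  assumes "admissible y" "t \<in> {a..b}"
  shows "T y t \<in> {0..R}"
proof -
  have "0 \<le> T y t"
    unfolding T_def set_lebesgue_integral_def
    by (rule integral_nonneg_AE)
       (use assms K_nonneg q_nonneg admissible_fD[OF assms(1)] in \<open>auto simp: indicator_def\<close>)
  moreover have "T y t \<le> (LINT s:{a..b}|lebesgue. M * (K t s * q s))"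
    unfolding T_def
  proof (rule set_integral_mono[OF integrand_integrable[OF assms]])
    show "set_integrable lebesgue {a..b} (\<lambda>s. M * (K t s * q s))"
      using K_q_integrable[OF assms(2)] by simp
    fix s assume s: "s \<in> {a..b}"
    have "K t s * q s * f (y s) \<le> K t s * q s * M"
      using admissible_fD[OF assms(1) s] K_nonneg[OF assms(2) s] q_nonneg[OF s]
      by (intro mult_left_mono) auto
    then show "K t s * q s * f (y s) \<le> M * (K t s * q s)" by (simp add: mult.commute)
  qed
  ultimately show ?thesis using self_map[OF assms(2)] by simp
qed

lemma M_nonneg: "0 \<le> M"
  using f_range[of 0] R by auto

text \<open>
  The modulus comes from the uniform continuity of the kernel and is the same for all \<open>y\<close>: this is
  what makes the operator compact.
\<close>

lemma T_equicontinuous: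
  assumes "0 < e"
  obtains d where "0 < d" "\<And>y t t'. admissible y \<Longrightarrow> t \<in> {a..b} \<Longrightarrow> t' \<in> {a..b} \<Longrightarrow>
    \<bar>t - t'\<bar> < d \<Longrightarrow> \<bar>T y t - T y t'\<bar> \<le> e"
proof -
  define \<eta> where "\<eta> = e / (M * weight_mass + 1)"
  have den: "0 < M * weight_mass + 1" using M_nonneg weight_mass_nonneg by (simp add: add_nonneg_pos)
  have \<eta>: "0 < \<eta>" using den assms by (simp add: \<eta>_def)
  have "uniformly_continuous_on ({a..b} \<times> {a..b}) (\<lambda>(t, s). K t s)"
    by (intro compact_uniformly_continuous K_cont compact_Times) auto
  then obtain d where d: "0 < d" and close: "\<And>p p'. p \<in> {a..b} \<times> {a..b} \<Longrightarrow> p' \<in> {a..b} \<times> {a..b} \<Longrightarrow>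
      dist p' p < d \<Longrightarrow> dist (case p' of (t, s) \<Rightarrow> K t s) (case p of (t, s) \<Rightarrow> K t s) < \<eta>"
    unfolding uniformly_continuous_on_def using \<eta> by metis
  have "\<bar>T y t - T y t'\<bar> \<le> e"
    if y: "admissible y" and t: "t \<in> {a..b}" "t' \<in> {a..b}" "\<bar>t - t'\<bar> < d" for y t t'
  proof -
    have K: "\<bar>K t s - K t' s\<bar> \<le> \<eta>" if "s \<in> {a..b}" for s
      using close[of "(t', s)" "(t, s)"] t that by (auto simp: dist_Pair_Pair dist_real_def)
    have "T y t - T y t' = (LINT s:{a..b}|lebesgue. K t s * q s * f (y s) - K t' s * q s * f (y s))"
      unfolding T_def using integrand_integrable y t by simp
    also have "\<dots> = (LINT s:{a..b}|lebesgue. (K t s - K t' s) * f (y s) * q s)"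
      by (simp add: algebra_simps)
    also have "\<bar>\<dots>\<bar> \<le> \<eta> * M * weight_mass"
      unfolding weight_mass_def
    proof (rule weighted_integral_bound(2)[OF q_int q_nonneg])
      show "set_borel_measurable lebesgue {a..b} (\<lambda>s. (K t s - K t' s) * f (y s))"
        using y by (intro set_borel_measurable_mult set_borel_measurable_diff K_measurable t)
                   (auto simp: admissible_def)
      show "\<bar>(K t s - K t' s) * f (y s)\<bar> \<le> \<eta> * M" if "s \<in> {a..b}" for s
        unfolding abs_mult
        using K[OF that] admissible_fD[OF y that] \<eta> by (intro mult_mono) auto
    qed
    also have "\<dots> \<le> \<eta> * (M * weight_mass + 1)" using \<eta> by (simp add: algebra_simps)
    also have "\<dots> = e" using den by (simp add: \<eta>_def)
    finally show ?thesis .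
  qed
  then show thesis using d that by blast
qed

text \<open>
  The modulus comes from the uniform continuity of \<open>f\<close> on \<open>{0..R}\<close>, so \<open>y\<close> and \<open>z\<close> may be
  discontinuous.
\<close>

lemma T_uniformly_continuous:
  assumes "0 < e"
  obtains d where "0 < d" "\<And>y z t. admissible y \<Longrightarrow> admissible z \<Longrightarrow>
    (\<And>s. s \<in> {a..b} \<Longrightarrow> \<bar>y s - z s\<bar> \<le> d) \<Longrightarrow> t \<in> {a..b} \<Longrightarrow> \<bar>T y t - T z t\<bar> \<le> e"
proof -
  obtain B where B: "0 < B" "\<And>t s. t \<in> {a..b} \<Longrightarrow> s \<in> {a..b} \<Longrightarrow> \<bar>K t s\<bar> \<le> B"
    using K_bounded by blast
  define \<eta> where "\<eta> = e / (B * weight_mass + 1)"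
  have den: "0 < B * weight_mass + 1" using B(1) weight_mass_nonneg by (simp add: add_nonneg_pos)
  have \<eta>: "0 < \<eta>" using den assms by (simp add: \<eta>_def)
  have "uniformly_continuous_on {0..R} f"
    by (intro compact_uniformly_continuous f_cont) auto
  then obtain d where d: "0 < d" and close: "\<And>x x'. x \<in> {0..R} \<Longrightarrow> x' \<in> {0..R} \<Longrightarrow>
      dist x' x < d \<Longrightarrow> dist (f x') (f x) < \<eta>"
    unfolding uniformly_continuous_on_def using \<eta> by metis
  have "\<bar>T y t - T z t\<bar> \<le> e"
    if y: "admissible y" and z: "admissible z" and yz: "\<And>s. s \<in> {a..b} \<Longrightarrow> \<bar>y s - z s\<bar> \<le> d / 2"
      and t: "t \<in> {a..b}" for y z t
  proof -
    have fyz: "\<bar>f (y s) - f (z s)\<bar> \<le> \<eta>" if "s \<in> {a..b}" for s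
      using close[of "z s" "y s"] yz[OF that] d admissible_fD[OF y that] admissible_fD[OF z that]
      by (auto simp: dist_real_def)
    have "T y t - T z t = (LINT s:{a..b}|lebesgue. K t s * q s * f (y s) - K t s * q s * f (z s))"
      unfolding T_def using integrand_integrable y z t by simp
    also have "\<dots> = (LINT s:{a..b}|lebesgue. K t s * (f (y s) - f (z s)) * q s)"
      by (simp add: algebra_simps)
    also have "\<bar>\<dots>\<bar> \<le> B * \<eta> * weight_mass"
      unfolding weight_mass_def
    proof (rule weighted_integral_bound(2)[OF q_int q_nonneg])
      show "set_borel_measurable lebesgue {a..b} (\<lambda>s. K t s * (f (y s) - f (z s)))"
        using y z by (intro set_borel_measurable_mult set_borel_measurable_diff K_measurable t)
                   (auto simp: admissible_def)
      show "\<bar>K t s * (f (y s) - f (z s))\<bar> \<le> B * \<eta>" if "s \<in> {a..b}" for s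
        unfolding abs_mult
        using fyz[OF that] B(1) B(2)[OF t that] by (intro mult_mono) auto
    qed
    also have "\<dots> \<le> \<eta> * (B * weight_mass + 1)" using \<eta> by (simp add: algebra_simps)
    also have "\<dots> = e" using den by (simp add: \<eta>_def)
    finally show ?thesis .
  qed
  then show thesis using d that[of "d / 2"] by simp
qed

lemma continuous_admissible:
  assumes "continuous_on {a..b} y" "y \<in> {a..b} \<rightarrow> {0..R}"
  shows "admissible y"
  unfolding admissible_def using assms
  by (auto intro!: set_borel_measurable_continuous_lebesgue continuous_on_compose2[OF f_cont assms(1)])

lemma T_continuous:
  assumes "admissible y"
  shows "continuous_on {a..b} (T y)"
  unfolding continuous_on_iff
proof (intro ballI allI impI)
  fix t e :: real assume t: "t \<in> {a..b}" and "0 < e"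
  then obtain d where "0 < d" "\<And>y t t'. admissible y \<Longrightarrow> t \<in> {a..b} \<Longrightarrow> t' \<in> {a..b} \<Longrightarrow>
    \<bar>t - t'\<bar> < d \<Longrightarrow> \<bar>T y t - T y t'\<bar> \<le> e / 2"
    using T_equicontinuous[of "e / 2"] by (metis half_gt_zero)
  then show "\<exists>d>0. \<forall>t'\<in>{a..b}. dist t' t < d \<longrightarrow> dist (T y t') (T y t) < e"
    using assms t \<open>0 < e\<close> by (intro exI[of _ d]) (fastforce simp: dist_real_def)
qed

lemma T_admissible: "admissible y \<Longrightarrow> admissible (T y)"
  by (rule continuous_admissible[OF T_continuous]) (use T_range in blast)+

lemma step_function_admissible:
  fixes h :: real and N :: nat
  assumes "0 < h" and x: "\<And>j. j \<le> N \<Longrightarrow> x j \<in> {0..R}" and "b - a \<le> real N * h"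
  shows "admissible (\<lambda>s. x (nat \<lfloor>(s - a) / h\<rfloor>))"
  unfolding admissible_def
proof (intro conjI Pi_I)
  fix s assume s: "s \<in> {a..b}"
  have "(s - a) / h \<le> N" using s assms by (simp add: divide_le_eq)
  then have "nat \<lfloor>(s - a) / h\<rfloor> \<le> N" by linarith
  then show "x (nat \<lfloor>(s - a) / h\<rfloor>) \<in> {0..R}" by (rule x)
next
  have "(\<lambda>s. f (x (nat \<lfloor>(s - a) / h\<rfloor>))) \<in> borel_measurable borel" by measurable
  then have "(\<lambda>s. f (x (nat \<lfloor>(s - a) / h\<rfloor>))) \<in> borel_measurable lebesgue"
    by (intro measurable_completion) simp
  then show "set_borel_measurable lebesgue {a..b} (\<lambda>s. f (x (nat \<lfloor>(s - a) / h\<rfloor>)))"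
    unfolding set_borel_measurable_def by (intro borel_measurable_scaleR borel_measurable_indicator) auto
qed

text \<open>
  Restrict the operator to step functions on a uniform grid and sample its values at the grid
  nodes.  This gives a self map of a finite-dimensional cube, hence a step function \<open>u\<close> with
  \<open>T u \<approx> u\<close> at the nodes.  Equicontinuity extends this to all points, because the grid is
  finer than the modulus of \<open>T u\<close>.  Applying \<open>T\<close> once more shows that the continuous function
  \<open>T u\<close> is almost fixed.
\<close>

lemma approximate_fixed_point:
  assumes "0 < e"
  obtains u where "admissible u" "\<And>t. t \<in> {a..b} \<Longrightarrow> \<bar>T (T u) t - T u t\<bar> \<le> e"
proof -
  obtain d where d: "0 < d" and Td: "\<And>y z t. admissible y \<Longrightarrow> admissible z \<Longrightarrow>
    (\<And>s. s \<in> {a..b} \<Longrightarrow> \<bar>y s - z s\<bar> \<le> d) \<Longrightarrow> t \<in> {a..b} \<Longrightarrow> \<bar>T y t - T z t\<bar> \<le> e"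
    using T_uniformly_continuous[OF assms] by blast
  obtain d' where d': "0 < d'" and Td': "\<And>y z t. admissible y \<Longrightarrow> admissible z \<Longrightarrow>
    (\<And>s. s \<in> {a..b} \<Longrightarrow> \<bar>y s - z s\<bar> \<le> d') \<Longrightarrow> t \<in> {a..b} \<Longrightarrow> \<bar>T y t - T z t\<bar> \<le> d / 4"
    using T_uniformly_continuous[of "d / 4"] d by (metis zero_less_divide_iff zero_less_numeral)
  obtain \<rho> where \<rho>: "0 < \<rho>" and T\<rho>: "\<And>y t t'. admissible y \<Longrightarrow> t \<in> {a..b} \<Longrightarrow> t' \<in> {a..b} \<Longrightarrow>
    \<bar>t - t'\<bar> < \<rho> \<Longrightarrow> \<bar>T y t - T y t'\<bar> \<le> d / 2"
    using T_equicontinuous[of "d / 2"] d by (metis half_gt_zero)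
  obtain N :: nat where N: "(b - a) / \<rho> < N" using reals_Archimedean2 by blast
  have N0: "0 < real N" using N ab \<rho> by (meson diff_gt_0_iff_gt divide_pos_pos order_less_trans)
  define h where "h = (b - a) / N"
  have h: "0 < h" "h < \<rho>" "N * h = b - a"
    using N N0 ab \<rho> by (auto simp: h_def field_simps)
  \<comment> \<open>There are \<open>N + 1\<close> nodes, since the point \<open>b\<close> gets the index \<open>N\<close>.\<close>
  define node where "node i = a + real i * h" for i :: nat
  define ix where "ix s = nat \<lfloor>(s - a) / h\<rfloor>" for s
  have node: "node i \<in> {a..b}" if "i \<le> N" for i
  proof -
    have "real i * h \<le> real N * h" using that h by (intro mult_right_mono) auto
    then show ?thesis using h by (simp add: node_def)
  qed
  have ix: "ix s \<le> N" "\<bar>s - node (ix s)\<bar> \<le> h" if s: "s \<in> {a..b}" for s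
  proof -
    have "(s - a) / h \<le> N" using s h by (simp add: divide_le_eq)
    then show "ix s \<le> N" unfolding ix_def by linarith
    have "0 \<le> (s - a) / h" using s h by simp
    then have "real (ix s) \<le> (s - a) / h" "(s - a) / h \<le> real (ix s) + 1"
      unfolding ix_def by linarith+
    then have "real (ix s) * h \<le> s - a" "s - a \<le> (real (ix s) + 1) * h"
      using h by (simp_all add: field_simps)
    then show "\<bar>s - node (ix s)\<bar> \<le> h" using h by (auto simp: node_def algebra_simps)
  qed
  have adm: "admissible (\<lambda>s. x (ix s))" if "\<And>j. j < Suc N \<Longrightarrow> x j \<in> {0..R}" for x
    unfolding ix_def by (rule step_function_admissible[where N = N and x = x and h = h]) (use h that in auto)
  define \<delta> where "\<delta> = min d' (d / 4)"
  obtain x where x: "\<And>j. j < Suc N \<Longrightarrow> x j \<in> {0..R}"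
    and near: "\<And>i. i < Suc N \<Longrightarrow> \<bar>T (\<lambda>s. x (ix s)) (node i) - x i\<bar> \<le> d / 4 + \<delta>"
  proof (rule approximate_fixed_point_cube[of R \<delta> "Suc N" "\<lambda>x i. T (\<lambda>s. x (ix s)) (node i)" "d / 4"])
    show "0 < R" "0 < \<delta>" using R d d' by (auto simp: \<delta>_def)
    show "T (\<lambda>s. x (ix s)) (node i) \<in> {0..R}"
      if "\<And>j. j < Suc N \<Longrightarrow> x j \<in> {0..R}" "i < Suc N" for x i
      using that node by (intro T_range adm) auto
    show "\<bar>T (\<lambda>s. x (ix s)) (node i) - T (\<lambda>s. x' (ix s)) (node i)\<bar> \<le> d / 4"
      if "\<And>j. j < Suc N \<Longrightarrow> x j \<in> {0..R}" "\<And>j. j < Suc N \<Longrightarrow> x' j \<in> {0..R}"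
        "\<And>j. j < Suc N \<Longrightarrow> \<bar>x j - x' j\<bar> \<le> \<delta>" "i < Suc N" for x x' i
    proof (intro Td' adm)
      show "\<bar>x (ix s) - x' (ix s)\<bar> \<le> d'" if "s \<in> {a..b}" for s
        using \<open>\<And>j. j < Suc N \<Longrightarrow> \<bar>x j - x' j\<bar> \<le> \<delta>\<close>[of "ix s"] ix(1)[OF that] by (simp add: \<delta>_def)
    qed (use that node in auto)
  qed blast
  define u where "u = (\<lambda>s. x (ix s))"
  have u: "admissible u" unfolding u_def by (rule adm) (rule x)
  have "\<bar>T u s - u s\<bar> \<le> d" if s: "s \<in> {a..b}" for s
  proof -
    \<comment> \<open>\<open>u\<close> is constant on grid cells, so \<open>u s\<close> is its value at the node \<open>ix s\<close>.\<close>
    have "\<bar>T u s - T u (node (ix s))\<bar> \<le> d / 2"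
      using ix[OF s] h by (intro T\<rho> u s node) auto
    moreover have "\<bar>T u (node (ix s)) - u s\<bar> \<le> d / 2"
    proof -
      have "\<delta> \<le> d / 4" by (simp add: \<delta>_def)
      then show ?thesis using near[of "ix s"] ix(1)[OF s] unfolding u_def by simp
    qed
    ultimately show ?thesis by linarith
  qed
  then have "\<bar>T (T u) t - T u t\<bar> \<le> e" if "t \<in> {a..b}" for t
    using that by (intro Td T_admissible u)
  then show thesis using that u by blast
qed

text \<open>
  Schauder's theorem for this operator.  Almost fixed points of the form \<open>T u\<close> are bounded
  and equicontinuous, so a subsequence converges uniformly by Arzela and Ascoli, and by
  continuity of \<open>T\<close> the limit is fixed.
\<close>

theorem fixed_point_exists:
  obtains y where "continuous_on {a..b} y" "y \<in> {a..b} \<rightarrow> {0..R}" "\<And>t. t \<in> {a..b} \<Longrightarrow> y t = T y t"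
proof -
  have "\<exists>u. admissible u \<and> (\<forall>t\<in>{a..b}. \<bar>T (T u) t - T u t\<bar> \<le> inverse (Suc n))" for n
    using approximate_fixed_point[of "inverse (Suc n)"] by (metis inverse_positive_iff_positive of_nat_0_less_iff zero_less_Suc)
  then obtain u where u: "\<And>n. admissible (u n)"
    and near: "\<And>n t. t \<in> {a..b} \<Longrightarrow> \<bar>T (T (u n)) t - T (u n) t\<bar> \<le> inverse (Suc n)"
    by metis
  define z where "z n = T (u n)" for n :: nat
  have z: "admissible (z n)" for n unfolding z_def by (intro T_admissible u)
  obtain y and k :: "nat \<Rightarrow> nat" where y: "continuous_on {a..b} y" and k: "strict_mono k"
    and lim: "\<And>e. 0 < e \<Longrightarrow> \<exists>N. \<forall>n t. n \<ge> N \<and> t \<in> {a..b} \<longrightarrow> norm (z (k n) t - y t) < e"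
  proof (rule Arzela_Ascoli[of "{a..b}" z R])
    show "norm (z n t) \<le> R" if "t \<in> {a..b}" for n t
      using T_range[OF u that] by (simp add: z_def)
    show "\<exists>d>0. \<forall>n t'. t' \<in> {a..b} \<and> norm (t - t') < d \<longrightarrow> norm (z n t - z n t') < e"
      if t: "t \<in> {a..b}" and e: "0 < e" for t e
    proof -
      obtain d where "0 < d" "\<And>y t t'. admissible y \<Longrightarrow> t \<in> {a..b} \<Longrightarrow> t' \<in> {a..b} \<Longrightarrow>
        \<bar>t - t'\<bar> < d \<Longrightarrow> \<bar>T y t - T y t'\<bar> \<le> e / 2"
        using T_equicontinuous[of "e / 2"] e by (metis half_gt_zero)
      then have "norm (z n t - z n t') < e" if "t' \<in> {a..b}" "norm (t - t') < d" for n t'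
        using u[of n] t e that unfolding z_def real_norm_def
        by (smt (verit) field_sum_of_halves)
      then show ?thesis using \<open>0 < d\<close> by blast
    qed
  qed auto
  have y_range: "y \<in> {a..b} \<rightarrow> {0..R}"
  proof
    fix t assume t: "t \<in> {a..b}"
    have "(\<lambda>n. z (k n) t) \<longlonglongrightarrow> y t"
      unfolding LIMSEQ_iff using lim t by meson
    moreover have "z (k n) t \<in> {0..R}" for n using T_range[OF u t] by (simp add: z_def)
    ultimately show "y t \<in> {0..R}" by (meson closed_atLeastAtMost closed_sequentially)
  qed
  have y_adm: "admissible y" by (rule continuous_admissible[OF y y_range])
  have "y t = T y t" if t: "t \<in> {a..b}" for t
  proof -
    have "\<bar>y t - T y t\<bar> \<le> e" if e: "0 < e" for e
    proof -
      obtain d where d: "0 < d" and Td: "\<And>y z t. admissible y \<Longrightarrow> admissible z \<Longrightarrow>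
          (\<And>s. s \<in> {a..b} \<Longrightarrow> \<bar>y s - z s\<bar> \<le> d) \<Longrightarrow> t \<in> {a..b} \<Longrightarrow> \<bar>T y t - T z t\<bar> \<le> e / 3"
        using T_uniformly_continuous[of "e / 3"] e by (metis zero_less_divide_iff zero_less_numeral)
      obtain N where N: "\<And>n s. n \<ge> N \<Longrightarrow> s \<in> {a..b} \<Longrightarrow> norm (z (k n) s - y s) < min d (e / 3)"
        using lim[of "min d (e / 3)"] d e by auto
      obtain N' where N': "inverse (real (Suc N')) < e / 3"
        using reals_Archimedean[of "e / 3"] e by auto
      define n where "n = max N N'"
      have "inverse (real (Suc (k n))) \<le> inverse (real (Suc N'))"
        using seq_suble[OF k, of n] by (intro le_imp_inverse_le) (auto simp: n_def)
      then have "\<bar>T (z (k n)) t - z (k n) t\<bar> \<le> e / 3"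
        using near[OF t, of "k n"] N' unfolding z_def by linarith
      moreover have "\<bar>T (z (k n)) t - T y t\<bar> \<le> e / 3"
        using N[of n] by (intro Td z y_adm t) (fastforce simp: n_def)
      moreover have "\<bar>z (k n) t - y t\<bar> \<le> e / 3"
        using N[of n t] t by (simp add: n_def)
      ultimately show ?thesis by linarith
    qed
    then show ?thesis using field_le_epsilon[of "\<bar>y t - T y t\<bar>" 0] by auto
  qed
  then show thesis using that y y_range by blast
qed

end

section \<open>Bounds for the Green function\<close>

lemma green_continuous_on:
  assumes "a < b" "1 < \<alpha>"
  shows "continuous_on ({a..b} \<times> {a..b}) (\<lambda>(t, s). green \<alpha> a b t s)"
proof -
  have eq: "(\<lambda>(t, s). green \<alpha> a b t s) = (\<lambda>x. 1 / Gamma \<alpha> *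
     ((fst x - a) powr (\<alpha> - 1) * (b - snd x) powr (\<alpha> - 1) / (b - a) powr (\<alpha> - 1)
       - max 0 (fst x - snd x) powr (\<alpha> - 1)))"
    by (auto simp: green_def g1_def g2_def fun_eq_iff max_def)
  show ?thesis
    unfolding eq using assms
    by (intro continuous_on_mult continuous_on_diff continuous_on_divide continuous_on_powr' continuous_on_max
          continuous_on_const continuous_on_fst continuous_on_snd continuous_on_id) auto
qed

lemma g2_mono:
  assumes "a < b" "1 < \<alpha>" "a \<le> t" "t \<le> t'"
  shows "g2 \<alpha> a b t s \<le> g2 \<alpha> a b t' s"
proof -
  have "(t - a) powr (\<alpha> - 1) \<le> (t' - a) powr (\<alpha> - 1)"
    using assms by (intro powr_mono2) auto
  moreover have "0 < Gamma \<alpha>" using assms by (intro Gamma_real_pos) auto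
  ultimately show ?thesis
    unfolding g2_def by (intro mult_left_mono divide_right_mono mult_right_mono) simp_all
qed

text \<open>
  Up to a positive factor the \<open>t\<close>-derivative is \<open>k (t - a) powr (p - 1) - (t - s) powr (p - 1)\<close> with
  \<open>p = \<alpha> - 1\<close> and \<open>k \<le> 1\<close>.  It is nonpositive because \<open>t - s \<le> t - a\<close> and the exponent \<open>p - 1\<close> is nonpositive:
  this is where \<open>\<alpha> \<le> 2\<close> enters.
\<close>

lemma g1_antimono:
  assumes ab: "a < b" and al: "1 < \<alpha>" "\<alpha> \<le> 2" and ord: "a \<le> s" "s \<le> t" "t \<le> t'" "t' \<le> b"
  shows "g1 \<alpha> a b t' s \<le> g1 \<alpha> a b t s"
proof -
  define p where "p = \<alpha> - 1"
  have p: "0 < p" "p \<le> 1" using al by (auto simp: p_def)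
  define k where "k = (b - s) powr p / (b - a) powr p"
  have k: "0 \<le> k" "k \<le> 1"
    using ab ord p by (auto simp: k_def divide_le_eq intro!: powr_mono2)
  define h where "h t = k * (t - a) powr p - (t - s) powr p" for t
  have "h t' \<le> h t"
  proof (rule DERIV_nonpos_imp_decreasing_open[OF ord(3)])
    fix x assume x: "t < x" "x < t'"
    have pos: "0 < x - s" "x - s \<le> x - a" using x ord by auto
    have "(h has_real_derivative p * (k * (x - a) powr (p - 1) - (x - s) powr (p - 1))) (at x)"
      unfolding h_def using pos by (auto intro!: derivative_eq_intros simp: algebra_simps)
    moreover have "k * (x - a) powr (p - 1) \<le> 1 * (x - s) powr (p - 1)"
      using k pos p by (intro mult_mono powr_mono2') auto
    ultimately show "\<exists>v. (h has_real_derivative v) (at x) \<and> v \<le> 0"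
      using p by (intro exI conjI) (auto simp: mult_le_0_iff)
  next
    show "continuous_on {t..t'} h"
      unfolding h_def using p ord
      by (intro continuous_on_minus continuous_on_diff continuous_on_mult
            continuous_on_powr' continuous_on_const continuous_on_id) auto
  qed
  moreover have "g1 \<alpha> a b x s = 1 / Gamma \<alpha> * h x" for x
    by (simp add: g1_def h_def k_def p_def)
  moreover have "0 < Gamma \<alpha>" using al by (intro Gamma_real_pos) auto
  ultimately show ?thesis by (simp add: divide_right_mono)
qed

text \<open>
  For \<open>t \<ge> s\<close> the Green function decreases in \<open>t\<close> to its value \<open>0\<close> at \<open>t = b\<close>.
\<close>

lemma green_nonneg:
  assumes "a < b" "1 < \<alpha>" "\<alpha> \<le> 2" "t \<in> {a..b}" "s \<in> {a..b}"
  shows "0 \<le> green \<alpha> a b t s"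
proof (cases "s \<le> t")
  case True
  have "g1 \<alpha> a b b s = 0" using assms by (simp add: g1_def)
  then show ?thesis using True g1_antimono[of a b \<alpha> s t b] assms by (simp add: green_def)
next
  case False
  then show ?thesis using assms Gamma_real_pos[of \<alpha>] by (simp add: green_def g2_def)
qed

text \<open>
  In \<open>t\<close>, the Green function increases up to \<open>s\<close> and decreases from there on.
\<close>

lemma green_le_diagonal:
  assumes "a < b" "1 < \<alpha>" "\<alpha> \<le> 2" "t \<in> {a..b}" "s \<in> {a..b}"
  shows "green \<alpha> a b t s \<le> green \<alpha> a b s s"
proof (cases "s \<le> t")
  case True
  then show ?thesis using g1_antimono[of a b \<alpha> s s t] assms by (simp add: green_def)
next
  case False
  then have "g2 \<alpha> a b t s \<le> g2 \<alpha> a b s s" using assms by (intro g2_mono) auto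
  then show ?thesis using False by (simp add: green_def g1_def g2_def)
qed

text \<open>
  The \<open>s\<close>-derivative has the sign of \<open>(d - s) powr (p - 1) - k (b - s) powr (p - 1)\<close> with \<open>p = \<alpha> - 1\<close>
  and \<open>k \<le> 1\<close>, which is nonnegative because \<open>d < b\<close> and \<open>p \<le> 1\<close>.  Therefore the switch point separates
  the points where \<open>g1 \<alpha> a b d\<close> is the smaller of the two functions from those where \<open>g2 \<alpha> a b c\<close> is.
\<close>

lemma g1_minus_g2_mono:
  fixes a b \<alpha> :: real
  defines "c \<equiv> (2 * a + b) / 3" and "d \<equiv> (a + 2 * b) / 3"
  assumes ab: "a < b" and al: "1 < \<alpha>" "\<alpha> \<le> 2" and ord: "s \<le> s'" "s' \<le> d"
  shows "g1 \<alpha> a b d s - g2 \<alpha> a b c s \<le> g1 \<alpha> a b d s' - g2 \<alpha> a b c s'"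
proof -
  define p where "p = \<alpha> - 1"
  have p: "0 < p" "p \<le> 1" using al by (auto simp: p_def)
  have cd: "a < c" "c < d" "d < b" using ab by (auto simp: c_def d_def)
  define k where "k = ((d - a) powr p - (c - a) powr p) / (b - a) powr p"
  have k: "k \<le> 1"
  proof -
    have "(d - a) powr p \<le> (b - a) powr p" using cd p by (intro powr_mono2) auto
    then have "(d - a) powr p - (c - a) powr p \<le> (b - a) powr p"
      by (smt (verit) powr_ge_zero)
    then show ?thesis using ab by (simp add: k_def divide_le_eq)
  qed
  define h where "h x = k * (b - x) powr p - (d - x) powr p" for x
  have "- h s' \<le> - h s"
  proof (rule DERIV_nonpos_imp_decreasing_open[OF ord(1)])
    fix x assume x: "s < x" "x < s'"
    have pos: "0 < d - x" "d - x \<le> b - x" using x ord cd by auto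
    have "((\<lambda>x. - h x) has_real_derivative p * (k * (b - x) powr (p - 1) - (d - x) powr (p - 1))) (at x)"
      unfolding h_def using pos by (auto intro!: derivative_eq_intros simp: algebra_simps)
    moreover have "k * (b - x) powr (p - 1) \<le> 1 * (d - x) powr (p - 1)"
      using k pos p by (intro mult_mono powr_mono2') auto
    ultimately show "\<exists>v. ((\<lambda>x. - h x) has_real_derivative v) (at x) \<and> v \<le> 0"
      using p by (intro exI conjI) (auto simp: mult_le_0_iff)
  next
    show "continuous_on {s..s'} (\<lambda>x. - h x)"
      unfolding h_def using p ord cd
      by (intro continuous_on_minus continuous_on_diff continuous_on_mult
            continuous_on_powr' continuous_on_const continuous_on_id) auto
  qed
  moreover have "g1 \<alpha> a b d x - g2 \<alpha> a b c x = 1 / Gamma \<alpha> * h x" for x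
    by (simp add: g1_def g2_def h_def k_def p_def diff_divide_distrib left_diff_distrib right_diff_distrib)
  moreover have "0 < Gamma \<alpha>" using al by (intro Gamma_real_pos) auto
  ultimately show ?thesis by (simp add: divide_right_mono)
qed

text \<open>
  The formula that defines \<open>phi\<close> is the quotient of one of the two boundary values, at the ends of
  the middle third, by the diagonal value of the Green function.
\<close>

lemma diagonal_times_phi:
  fixes a b \<alpha> s :: real
  defines "c \<equiv> (2 * a + b) / 3" and "d \<equiv> (a + 2 * b) / 3"
  assumes ab: "a < b" and al: "1 < \<alpha>" "\<alpha> \<le> 2" and s: "a < s" "s \<le> d"
  shows "green \<alpha> a b s s * phi \<alpha> a b s =
    (if s \<le> switch_point \<alpha> a b then g1 \<alpha> a b d s else g2 \<alpha> a b c s)"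
proof -
  define p where "p = \<alpha> - 1"
  have bs: "0 < b - s" "0 < s - a" "0 \<le> d - s" using s ab by (auto simp: d_def)
  have diag: "green \<alpha> a b s s = 1 / Gamma \<alpha> * ((s - a) * (b - s)) powr p / (b - a) powr p"
    using bs by (simp add: green_def g1_def p_def powr_mult)
  have "green \<alpha> a b s s * phi \<alpha> a b s = g1 \<alpha> a b d s" if le: "s \<le> switch_point \<alpha> a b"
  proof -
    have num: "(2 * (b - a) * (b - s) / 3) powr p = (d - a) powr p * (b - s) powr p"
    proof -
      have "2 * (b - a) * (b - s) / 3 = (d - a) * (b - s)" by (simp add: d_def field_simps)
      moreover have "0 \<le> d - a" using ab by (simp add: d_def)
      ultimately show ?thesis using bs by (simp only: powr_mult less_imp_le)
    qed
    have cancel: "1 / G * D / B * (X / D) = 1 / G * (X / B)" if "D \<noteq> 0" for G D B X :: real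
      using that by simp
    have ne: "((s - a) * (b - s)) powr p \<noteq> 0" "(b - a) powr p \<noteq> 0" using bs ab by auto
    show ?thesis
      unfolding diag phi_def g1_def p_def[symmetric] d_def[symmetric] num if_P[OF le]
        cancel[OF ne(1)]
      using ne(2) by (simp add: diff_divide_distrib)
  qed
  moreover have "green \<alpha> a b s s * phi \<alpha> a b s = g2 \<alpha> a b c s" if gt: "\<not> s \<le> switch_point \<alpha> a b"
  proof -
    have "(b - a) / (3 * (s - a)) = (c - a) / (s - a)" using bs by (simp add: c_def field_simps)
    then have "((b - a) / (3 * (s - a))) powr p = (c - a) powr p / (s - a) powr p"
      using bs ab by (simp add: powr_divide c_def)
    moreover have "(s - a) powr p \<noteq> 0" using bs by auto
    moreover have "((s - a) * (b - s)) powr p = (s - a) powr p * (b - s) powr p"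
      using bs by (simp add: powr_mult)
    ultimately show ?thesis
      unfolding diag phi_def g2_def p_def[symmetric] if_not_P[OF gt] by simp
  qed
  ultimately show ?thesis by simp
qed

lemma diagonal_times_phi_nonneg:
  assumes ab: "a < b" and al: "1 < \<alpha>" "\<alpha> \<le> 2" and s: "s \<in> {(2 * a + b) / 3 .. (a + 2 * b) / 3}"
  shows "0 \<le> green \<alpha> a b s s * phi \<alpha> a b s"
proof -
  have "0 \<le> g1 \<alpha> a b ((a + 2 * b) / 3) s"
    using green_nonneg[of a b \<alpha> "(a + 2 * b) / 3" s] ab al s by (simp add: green_def)
  moreover have "0 \<le> g2 \<alpha> a b ((2 * a + b) / 3) s"
    using ab al Gamma_real_pos[of \<alpha>] by (simp add: g2_def)
  moreover have "a < s" using ab s by auto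
  ultimately show ?thesis
    using ab al s by (subst diagonal_times_phi) auto
qed

text \<open>
  Since the Green function is unimodal in \<open>t\<close>, its minimum over \<open>t\<close> in the middle third is attained
  at an end: it is at least the smaller of \<open>g1\<close> at the right end and \<open>g2\<close> at the left end, and
  \<open>phi\<close> with its switch point selects this smaller value.
\<close>

lemma green_ge_diagonal_times_phi:
  assumes ab: "a < b" and al: "1 < \<alpha>" "\<alpha> \<le> 2"
    and s: "s \<in> {(2 * a + b) / 3 .. (a + 2 * b) / 3}" and t: "t \<in> {(2 * a + b) / 3 .. (a + 2 * b) / 3}"
  shows "green \<alpha> a b s s * phi \<alpha> a b s \<le> green \<alpha> a b t s"
proof -
  define c d where "c = (2 * a + b) / 3" and "d = (a + 2 * b) / 3"
  define l where "l = switch_point \<alpha> a b"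
  have cd: "a < c" "c < d" "d < b" using ab by (auto simp: c_def d_def)
  have st: "s \<in> {c..d}" "t \<in> {c..d}" using s t by (auto simp: c_def d_def)
  have l: "c < l" "l < d" "g1 \<alpha> a b d l = g2 \<alpha> a b c l"
    using theI'[OF switch_point_ex1[OF ab al]]
    unfolding l_def c_def d_def switch_point_def by auto
  have low: "(if s \<le> l then g1 \<alpha> a b d s else g2 \<alpha> a b c s) \<le> g1 \<alpha> a b d s"
       "(if s \<le> l then g1 \<alpha> a b d s else g2 \<alpha> a b c s) \<le> g2 \<alpha> a b c s"
    using g1_minus_g2_mono[OF ab al, of s l] g1_minus_g2_mono[OF ab al, of l s] l st
    by (auto simp: c_def[symmetric] d_def[symmetric])
  have "(if s \<le> l then g1 \<alpha> a b d s else g2 \<alpha> a b c s) \<le> green \<alpha> a b t s"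
  proof (cases "s \<le> t")
    case True
    have "g1 \<alpha> a b d s \<le> g1 \<alpha> a b t s" using cd st True by (intro g1_antimono ab al) auto
    then show ?thesis using low(1) True by (simp add: green_def)
  next
    case False
    have "g2 \<alpha> a b c s \<le> g2 \<alpha> a b t s" using cd st by (intro g2_mono ab al) auto
    then show ?thesis using low(2) False by (simp add: green_def)
  qed
  moreover have "a < s" "s \<le> d" using cd st by auto
  ultimately show ?thesis
    using diagonal_times_phi[OF ab al, of s] unfolding c_def[symmetric] d_def[symmetric] l_def[symmetric] by simp
qed

section \<open>The Green operator and the existence of a solution\<close>

text \<open>
  Drop the part of the integral outside the middle third, where the integrand is nonnegative, and
  bound the Green function from below by \<open>green \<alpha> a b s s * phi \<alpha> a b s\<close> on the rest.
\<close>

lemma green_operator_ge_on_middle_third: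
  fixes a b \<alpha> C :: real and q g :: "real \<Rightarrow> real"
  defines "I \<equiv> {(2 * a + b) / 3 .. (a + 2 * b) / 3}"
  assumes ab: "a < b" and al: "1 < \<alpha>" "\<alpha> \<le> 2" and t: "t \<in> I"
    and q: "\<And>s. s \<in> {a..b} \<Longrightarrow> 0 \<le> q s"
    and g: "\<And>s. s \<in> {a..b} \<Longrightarrow> C \<le> g s" and C: "0 \<le> C"
    and int: "set_integrable lebesgue {a..b} (\<lambda>s. green \<alpha> a b t s * q s * g s)"
    and nz: "gamma_star_integral \<alpha> a b q \<noteq> 0"
  shows "C * gamma_star_integral \<alpha> a b q \<le> (LINT s:{a..b}|lebesgue. green \<alpha> a b t s * q s * g s)"
proof -
  let ?k = "\<lambda>s. green \<alpha> a b s s * phi \<alpha> a b s * q s"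
  have sub: "s \<in> {a..b}" if "s \<in> I" for s using that ab by (auto simp: I_def)
  have tab: "t \<in> {a..b}" by (rule sub[OF t])
  \<comment> \<open>The integral of a function that is not integrable is \<open>0\<close> by convention.\<close>
  have "integrable lebesgue (\<lambda>s. indicator I s *\<^sub>R ?k s)"
    using nz not_integrable_integral_eq
    unfolding gamma_star_integral_def set_lebesgue_integral_def I_def by blast
  then have intC: "integrable lebesgue (\<lambda>s. C * (indicator I s *\<^sub>R ?k s))" by simp
  have "C * gamma_star_integral \<alpha> a b q = (LINT s|lebesgue. C * (indicator I s *\<^sub>R ?k s))"
    by (simp add: gamma_star_integral_def set_lebesgue_integral_def I_def)
  also have "\<dots> \<le> (LINT s:{a..b}|lebesgue. green \<alpha> a b t s * q s * g s)"
    unfolding set_lebesgue_integral_def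
  proof (rule integral_mono[OF intC int[unfolded set_integrable_def]])
    fix s
    consider "s \<in> I" | "s \<notin> I" "s \<in> {a..b}" | "s \<notin> {a..b}" by blast
    then show "C * (indicator I s *\<^sub>R ?k s) \<le> indicator {a..b} s *\<^sub>R (green \<alpha> a b t s * q s * g s)"
    proof cases
      case 1
      have "?k s * C \<le> green \<alpha> a b t s * q s * g s"
      proof (rule mult_mono)
        show "?k s \<le> green \<alpha> a b t s * q s"
          using green_ge_diagonal_times_phi[OF ab al, of s t] 1 t q[OF sub[OF 1]]
          unfolding I_def by (intro mult_right_mono)
        show "0 \<le> green \<alpha> a b t s * q s"
          using green_nonneg[OF ab al tab sub[OF 1]] q[OF sub[OF 1]] by simp
      qed (use g[OF sub[OF 1]] C in auto)
      then show ?thesis using 1 sub[OF 1] by (simp add: mult.commute)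
    next
      case 2
      then have "0 \<le> green \<alpha> a b t s * q s * g s"
        using green_nonneg[OF ab al tab] q g C by (intro mult_nonneg_nonneg) (auto intro: order_trans)
      then show ?thesis using 2 by simp
    next
      case 3
      then show ?thesis using sub by (auto simp: indicator_def)
    qed
  qed
  finally show ?thesis .
qed

lemma gamma_star_integral_nonneg:
  assumes ab: "a < b" and al: "1 < \<alpha>" "\<alpha> \<le> 2" and q: "\<And>s. s \<in> {a..b} \<Longrightarrow> 0 \<le> q s"
  shows "0 \<le> gamma_star_integral \<alpha> a b q"
  unfolding gamma_star_integral_def set_lebesgue_integral_def
proof (rule integral_nonneg_AE, rule AE_I2)
  fix s
  let ?I = "{(2 * a + b) / 3 .. (a + 2 * b) / 3}"
  have "0 \<le> green \<alpha> a b s s * phi \<alpha> a b s * q s" if "s \<in> ?I"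
    using that ab by (intro mult_nonneg_nonneg[OF diagonal_times_phi_nonneg[OF ab al that] q]) auto
  then show "0 \<le> indicator ?I s *\<^sub>R (green \<alpha> a b s s * phi \<alpha> a b s * q s)"
    by (simp add: indicator_def)
qed

text \<open>
  This is the self-map condition for the Green operator.  It holds because the Green
  function is largest on the diagonal.
\<close>

lemma green_integral_le_gamma_const:
  assumes ab: "a < b" and al: "1 < \<alpha>" "\<alpha> \<le> 2" and t: "t \<in> {a..b}"
    and q: "\<And>s. s \<in> {a..b} \<Longrightarrow> 0 \<le> q s" "set_integrable lebesgue {a..b} q"
    and pos: "0 \<le> gamma_const \<alpha> a b q"
  shows "gamma_const \<alpha> a b q * (LINT s:{a..b}|lebesgue. green \<alpha> a b t s * q s) \<le> 1"
proof -
  have integrable: "set_integrable lebesgue {a..b} (\<lambda>s. green \<alpha> a b (\<tau> s) s * q s)"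
    if \<tau>: "continuous_on {a..b} \<tau>" "\<tau> ` {a..b} \<subseteq> {a..b}" for \<tau>
  proof (rule weighted_integral_bound(1)[OF q(2) q(1)])
    have cont: "continuous_on {a..b} (\<lambda>s. green \<alpha> a b (\<tau> s) s)"
    proof -
      have "continuous_on {a..b} (\<lambda>s. (\<tau> s, s))"
        by (intro continuous_on_Pair \<tau>(1) continuous_on_id)
      moreover have "(\<lambda>s. (\<tau> s, s)) ` {a..b} \<subseteq> {a..b} \<times> {a..b}" using \<tau>(2) by auto
      ultimately show ?thesis
        using continuous_on_compose2[OF green_continuous_on[OF ab al(1)]] by fastforce
    qed
    show "set_borel_measurable lebesgue {a..b} (\<lambda>s. green \<alpha> a b (\<tau> s) s)"
      by (rule set_borel_measurable_continuous_lebesgue[OF cont])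
    show "\<bar>green \<alpha> a b (\<tau> s) s\<bar> \<le> (SUP s\<in>{a..b}. \<bar>green \<alpha> a b (\<tau> s) s\<bar>)" if "s \<in> {a..b}" for s
      using that compact_continuous_image[OF continuous_on_rabs[OF cont]]
      by (intro cSUP_upper bounded_imp_bdd_above compact_imp_bounded) auto
  qed
  have "(LINT s:{a..b}|lebesgue. green \<alpha> a b t s * q s) \<le> (LINT s:{a..b}|lebesgue. green \<alpha> a b s s * q s)"
  proof (rule set_integral_mono)
    show "set_integrable lebesgue {a..b} (\<lambda>s. green \<alpha> a b t s * q s)"
      by (rule integrable) (use t in auto)
    show "set_integrable lebesgue {a..b} (\<lambda>s. green \<alpha> a b s s * q s)"
      by (rule integrable) (auto intro: continuous_on_id)
  qed (intro mult_right_mono green_le_diagonal ab al t q(1))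
  then have "gamma_const \<alpha> a b q * (LINT s:{a..b}|lebesgue. green \<alpha> a b t s * q s)
      \<le> gamma_const \<alpha> a b q * (LINT s:{a..b}|lebesgue. green \<alpha> a b s s * q s)"
    using pos by (intro mult_left_mono)
  \<comment> \<open>The product is \<open>1\<close>, or \<open>0\<close> if the integral vanishes, since \<open>inverse 0 = 0\<close>.\<close>
  also have "\<dots> \<le> 1"
    unfolding gamma_const_def
    by (cases "(LINT s:{a..b}|lebesgue. green \<alpha> a b s s * q s) = 0") simp_all
  finally show ?thesis .
qed

theorem theorem8:
  fixes a b \<alpha> r1 r2 :: real and f q :: "real \<Rightarrow> real"
  assumes "a < b"
    and "1 < \<alpha>" and "\<alpha> \<le> 2"
    and "continuous_on {0..} f" and "\<And>x. 0 \<le> x \<Longrightarrow> 0 \<le> f x"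
    and "\<And>t. t \<in> {a..b} \<Longrightarrow> 0 \<le> q t"
    and "set_integrable lebesgue {a..b} q"
    and "\<not> (AE t in lebesgue. t \<in> {a..b} \<longrightarrow> q t = 0)"
    and "gamma_star_integral \<alpha> a b q \<noteq> 0"
    and "0 < r1" and "r1 < r2"
    and "\<And>x. x \<in> {0..r1} \<Longrightarrow> gamma_star \<alpha> a b q * r1 \<le> f x"
    and "\<And>x. x \<in> {0..r2} \<Longrightarrow> f x \<le> gamma_const \<alpha> a b q * r2"
  shows "\<exists>y. bvp_positive_solution \<alpha> a b q f y \<and> (\<exists>t\<in>{a..b}. y t \<noteq> 0) \<and>
             r1 \<le> sup_norm a b y \<and> sup_norm a b y \<le> r2"
proof -
  note ab = assms(1) and al = assms(2,3) and q = assms(6,7)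
  have r2: "0 < r2" using assms(10,11) by simp
  have "0 \<le> gamma_const \<alpha> a b q * r2" using assms(5)[of 0] assms(13)[of 0] r2 by simp
  then have gamma: "0 \<le> gamma_const \<alpha> a b q" using r2 by (simp add: zero_le_mult_iff)
  interpret hammerstein a b r2 "gamma_const \<alpha> a b q * r2" "green \<alpha> a b" q f
  proof
    show "continuous_on {0..r2} f" by (rule continuous_on_subset[OF assms(4)]) auto
    show "f x \<in> {0..gamma_const \<alpha> a b q * r2}" if "x \<in> {0..r2}" for x
      using that assms(5,13) by simp
    show "gamma_const \<alpha> a b q * r2 * (LINT s:{a..b}|lebesgue. green \<alpha> a b t s * q s) \<le> r2"
      if "t \<in> {a..b}" for t
      using mult_right_mono[OF green_integral_le_gamma_const[OF ab al that q gamma], of r2] r2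
      by (simp add: mult_ac)
  qed (use ab al q r2 green_continuous_on green_nonneg in auto)
  obtain y where y: "continuous_on {a..b} y" "y \<in> {a..b} \<rightarrow> {0..r2}"
    and fixed: "\<And>t. t \<in> {a..b} \<Longrightarrow> y t = T y t"
    by (rule fixed_point_exists) blast
  have sol: "bvp_positive_solution \<alpha> a b q f y"
    unfolding bvp_positive_solution_def T_def[symmetric]
  proof (intro conjI ballI)
    show "0 \<le> y t" if "t \<in> {a..b}" for t using y(2) that by auto
  qed (use y fixed in blast)+
  have "\<exists>t\<in>{a..b}. r1 \<le> y t"
  proof (rule ccontr)
    assume "\<not> (\<exists>t\<in>{a..b}. r1 \<le> y t)"
    then have small: "y s \<in> {0..r1}" if "s \<in> {a..b}" for s using y(2) that by force
    define c where "c = (2 * a + b) / 3"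
    have c: "c \<in> {(2 * a + b) / 3 .. (a + 2 * b) / 3}" "c \<in> {a..b}" using ab by (auto simp: c_def)
    \<comment> \<open>Any point of the middle third would do in place of \<open>c\<close>.\<close>
    have "0 \<le> gamma_star \<alpha> a b q * r1"
      using gamma_star_integral_nonneg[OF ab al q(1)] assms(10) by (simp add: gamma_star_def)
    then have "gamma_star \<alpha> a b q * r1 * gamma_star_integral \<alpha> a b q \<le> T y c"
      unfolding T_def
      by (intro green_operator_ge_on_middle_third ab al c q(1) assms(9,12) small
            integrand_integrable continuous_admissible y)
    moreover have "gamma_star \<alpha> a b q * r1 * gamma_star_integral \<alpha> a b q = r1"
      using assms(9) by (simp add: gamma_star_def)
    ultimately have "r1 \<le> y c" using fixed[OF c(2)] by simp
    then show False using \<open>\<not> (\<exists>t\<in>{a..b}. r1 \<le> y t)\<close> c(2) by blast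
  qed
  then obtain t where t: "t \<in> {a..b}" "r1 \<le> y t" by blast
  have bound: "\<bar>y s\<bar> \<le> r2" if "s \<in> {a..b}" for s using y(2) that by force
  have "r1 \<le> \<bar>y t\<bar>" using t(2) by simp
  also have "\<dots> \<le> sup_norm a b y"
    unfolding sup_norm_def using bound by (intro cSUP_upper t(1) bdd_aboveI2)
  finally have "r1 \<le> sup_norm a b y" .
  moreover have "sup_norm a b y \<le> r2"
    unfolding sup_norm_def using bound ab by (intro cSUP_least) auto
  moreover have "y t \<noteq> 0" using t(2) assms(10) by simp
  ultimately show ?thesis using sol t(1) by blast
qed

end
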